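(* Let $k,n,s$ be positive integers and let $x_1,\dots,x_n$ be independent variables. Then \[ M_{k}^{(s)}(x_{1},\ldots,x_{n})=\sum_{j=0}^{\lfloor k/(s+1) \rfloor} h_{j}(x_{1}^{s+1},\ldots,x_{n}^{s+1})\,e_{k-(s+1)j}(x_{1},\ldots,x_{n}). \]
   Context: $M_{k}^{(s)}(x_{1},\ldots,x_{n})=\sum x_{1}^{a_{1}}\cdots x_{n}^{a_{n}}$, the sum over all $n$-tuples of nonnegative integers with $a_1+\cdots+a_n=k$ and each $a_i\equiv 0$ or $1 \pmod{s+1}$. $h_j$ and $e_j$ denote the complete homogeneous and elementary symmetric polynomials of degree $j$ (with $h_0=e_0=1$ and $e_j=0$ for $j>n$). *)

theory Defs
  imports "HOL-Library.Poly_Mapping" "HOL-Library.FuncSet" "HOL-Number_Theory.Cong"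
begin

text \<open>
  Polynomials over \<open>'a\<close> in indeterminates indexed by the natural numbers: a monomial is a
  finitely supported exponent vector \<open>nat \<Rightarrow>\<^sub>0 nat\<close>, a polynomial a finitely supported map from
  monomials to coefficients. Multiplication on this type is convolution, i.e. the usual product.
\<close>

type_synonym 'a mpoly = "(nat \<Rightarrow>\<^sub>0 nat) \<Rightarrow>\<^sub>0 'a"

definition indet :: "nat \<Rightarrow> 'a::comm_ring_1 mpoly" where
  "indet i = Poly_Mapping.single (Poly_Mapping.single i 1) 1"

text \<open>
  Tuples \<open>(a\<^sub>1, \<dots>, a\<^sub>n)\<close> of natural numbers are extensional functions on \<open>{1..n}\<close>, so that
  each tuple is represented exactly once.
\<close>

definition weak_compositions :: "nat \<Rightarrow> nat \<Rightarrow> (nat \<Rightarrow> nat) set" where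
  "weak_compositions n k = {a \<in> {1..n} \<rightarrow>\<^sub>E UNIV. (\<Sum>i=1..n. a i) = k}"

lemma finite_weak_compositions: "finite (weak_compositions n k)"
proof (rule finite_subset)
  show "weak_compositions n k \<subseteq> {1..n} \<rightarrow>\<^sub>E {..k}"
  proof
    fix a assume a: "a \<in> weak_compositions n k"
    have "a i \<le> k" if "i \<in> {1..n}" for i
    proof -
      have "a i \<le> (\<Sum>i=1..n. a i)"
        using that by (intro member_le_sum) auto
      then show ?thesis using a by (simp add: weak_compositions_def)
    qed
    then show "a \<in> {1..n} \<rightarrow>\<^sub>E {..k}"
      using a by (auto simp: weak_compositions_def PiE_iff)
  qed
  show "finite ({1..n} \<rightarrow>\<^sub>E {..k})"
    by (intro finite_PiE) auto
qed

text \<open>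
  The three symmetric polynomials are defined at an arbitrary family \<open>x 1, \<dots>, x n\<close> of elements
  of a commutative ring, so that expressions such as \<open>h\<^sub>j(x\<^sub>1\<^sup>m, \<dots>, x\<^sub>n\<^sup>m)\<close> are direct instances.
\<close>

definition complete_hom :: "nat \<Rightarrow> nat \<Rightarrow> (nat \<Rightarrow> 'r::comm_ring_1) \<Rightarrow> 'r" where
  "complete_hom n j x = (\<Sum>a \<in> weak_compositions n j. \<Prod>i=1..n. x i ^ a i)"

definition elem_sym :: "nat \<Rightarrow> nat \<Rightarrow> (nat \<Rightarrow> 'r::comm_ring_1) \<Rightarrow> 'r" where
  "elem_sym n j x = (\<Sum>I | I \<subseteq> {1..n} \<and> card I = j. \<Prod>i\<in>I. x i)"

definition M_sym :: "nat \<Rightarrow> nat \<Rightarrow> nat \<Rightarrow> (nat \<Rightarrow> 'r::comm_ring_1) \<Rightarrow> 'r" where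
  "M_sym s n k x =
    (\<Sum>a | a \<in> weak_compositions n k \<and> (\<forall>i\<in>{1..n}. [a i = 0] (mod (s + 1)) \<or> [a i = 1] (mod (s + 1))).
       \<Prod>i=1..n. x i ^ a i)"

end

theory Submission
  imports Defs
begin

text \<open>
  Division with remainder by \<open>s + 1 \<ge> 2\<close> writes an exponent tuple \<open>a\<close> with all residues in
  \<open>{0, 1}\<close> uniquely as \<open>a = (s + 1) b + 1\<^sub>I\<close>. The tuple \<open>b\<close> selects a monomial of \<open>h\<^sub>j\<close>, where
  \<open>j\<close> is the sum of \<open>b\<close>, and the set \<open>I\<close> selects a monomial of \<open>e\<^bsub>k - (s + 1) j\<^esub>\<close>.
\<close>

lemma sum_of_bool_mem_eq_card:
  fixes n :: nat
  assumes "I \<subseteq> {1..n}"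
  shows "(\<Sum>i=1..n. of_bool (i \<in> I)) = card I"
proof -
  have "{1..n} \<inter> {i. i \<in> I} = I"
    using assms by blast
  then show ?thesis
    by (simp add: of_bool_def sum.If_cases)
qed

lemma prod_pow_of_bool_mem:
  fixes x :: "nat \<Rightarrow> 'r::comm_ring_1"
  assumes "I \<subseteq> {1..n}"
  shows "(\<Prod>i=1..n. x i ^ of_bool (i \<in> I)) = (\<Prod>i\<in>I. x i)"
  by (rule prod.mono_neutral_cong_right) (use assms in auto)

text \<open>The bijection matches the two sides summand by summand, so the identity holds at any
  family of elements of a commutative ring; the polynomial identity is the instance at the
  indeterminates.\<close>

lemma M_sym_eq_sum_complete_hom_elem_sym:
  fixes x :: "nat \<Rightarrow> 'r::comm_ring_1"
  assumes "s > 0"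
  shows "M_sym s n k x =
    (\<Sum>j=0..k div (s + 1).
       complete_hom n j (\<lambda>i. x i ^ (s + 1)) * elem_sym n (k - (s + 1) * j) x)"
proof -
  define m where "m = s + 1"
  \<comment> \<open>This makes 0 and 1 distinct residues modulo \<open>m\<close>, so that
    \<open>of_bool\<close> can serve as the remainder in a division by \<open>m\<close>.\<close>
  have m: "m > 1"
    using assms by (simp add: m_def)
  define A where "A = {a \<in> weak_compositions n k. \<forall>i\<in>{1..n}. a i mod m \<in> {0, 1}}"
  \<comment> \<open>\<open>B\<close> indexes the summands of the expanded right-hand side. If
    \<open>k - m * j > n\<close>, no \<open>I\<close> fits and the fibre over \<open>j\<close> is
    empty, in accordance with the vanishing of that elementary symmetric polynomial.\<close>
  define B where "B = (SIGMA j:{0..k div m}.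
    weak_compositions n j \<times> {I. I \<subseteq> {1..n} \<and> card I = k - m * j})"
  define quot where "quot a = restrict (\<lambda>i. a i div m) {1..n}" for a :: "nat \<Rightarrow> nat"
  define odds where "odds a = {i \<in> {1..n}. a i mod m = 1}" for a :: "nat \<Rightarrow> nat"
  define split where "split a = (\<Sum>i=1..n. a i div m, quot a, odds a)" for a
  \<comment> \<open>The restriction gives the value \<open>undefined\<close> outside
    \<open>{1..n}\<close>, as every extensional tuple has, so that \<open>join\<close> inverts
    \<open>split\<close> as an equality of functions.\<close>
  define join where
    "join = (\<lambda>(j::nat, b, I). restrict (\<lambda>i. m * b i + of_bool (i \<in> I)) {1..n})"

  have decomp: "a i = m * (a i div m) + of_bool (i \<in> odds a)" if "a \<in> A" "i \<in> {1..n}" for a i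
  proof -
    have "a i mod m \<in> {0, 1}"
      using that unfolding A_def by blast
    then have "a i mod m = of_bool (i \<in> odds a)"
      using that(2) by (auto simp: odds_def)
    then show ?thesis
      by (metis mult_div_mod_eq)
  qed

  have "M_sym s n k x = (\<Sum>a\<in>A. \<Prod>i=1..n. x i ^ a i)"
    using m unfolding M_sym_def A_def m_def[symmetric] by (simp add: cong_def)
  also have "\<dots> = (\<Sum>(j, b, I)\<in>B. (\<Prod>i=1..n. (x i ^ m) ^ b i) * (\<Prod>i\<in>I. x i))"
  proof (rule sum.reindex_bij_witness[where i = join and j = split])
    fix a assume a: "a \<in> A"
    show "join (split a) = a"
    proof
      fix i show "join (split a) i = a i"
      proof (cases "i \<in> {1..n}")
        case True
        then show ?thesis
          using decomp[OF a True] by (simp add: join_def split_def quot_def)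
      next
        case False
        then show ?thesis
          using a by (auto simp: join_def split_def A_def weak_compositions_def PiE_def extensional_def)
      qed
    qed
    have odds: "odds a \<subseteq> {1..n}"
      by (auto simp: odds_def)
    have "k = (\<Sum>i=1..n. a i)"
      using a by (simp add: A_def weak_compositions_def)
    also have "\<dots> = (\<Sum>i=1..n. m * (a i div m) + of_bool (i \<in> odds a))"
      using decomp[OF a] by (rule sum.cong[OF refl])
    also have "\<dots> = m * (\<Sum>i=1..n. a i div m) + card (odds a)"
      by (simp only: sum.distrib sum_distrib_left sum_of_bool_mem_eq_card[OF odds])
    finally have k: "k = m * (\<Sum>i=1..n. a i div m) + card (odds a)" .
    \<comment> \<open>Since the cardinality is nonnegative, the sum of the quotients lies in the
      range of \<open>j\<close>.\<close>
    then have "(\<Sum>i=1..n. a i div m) * m \<le> k"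
      by (simp add: mult.commute)
    then have "(\<Sum>i=1..n. a i div m) \<le> k div m"
      using m by (simp add: less_eq_div_iff_mult_less_eq)
    moreover have "card (odds a) = k - m * (\<Sum>i=1..n. a i div m)"
      using k by linarith
    moreover have "quot a \<in> weak_compositions n (\<Sum>i=1..n. a i div m)"
      by (simp add: weak_compositions_def quot_def)
    ultimately show "split a \<in> B"
      using odds by (simp add: split_def B_def)
    \<comment> \<open>The monomial factors along \<open>decomp\<close>: quotients become exponents
      of \<open>x i ^ m\<close>, remainders select the squarefree part.\<close>
    have "(\<Prod>i=1..n. x i ^ a i)
        = (\<Prod>i=1..n. (x i ^ m) ^ quot a i * x i ^ of_bool (i \<in> odds a))"
    proof (rule prod.cong[OF refl])
      fix i assume i: "i \<in> {1..n}"
      have "x i ^ a i = x i ^ (m * (a i div m) + of_bool (i \<in> odds a))"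
        using decomp[OF a i] by (rule arg_cong)
      then show "x i ^ a i = (x i ^ m) ^ quot a i * x i ^ of_bool (i \<in> odds a)"
        using i by (simp only: power_add power_mult quot_def restrict_apply if_True)
    qed
    also have "\<dots> = (\<Prod>i=1..n. (x i ^ m) ^ quot a i) * (\<Prod>i\<in>odds a. x i)"
      by (simp only: prod.distrib prod_pow_of_bool_mem[OF odds])
    finally show "(case split a of (j, b, I) \<Rightarrow>
        (\<Prod>i=1..n. (x i ^ m) ^ b i) * (\<Prod>i\<in>I. x i)) = (\<Prod>i=1..n. x i ^ a i)"
      by (simp add: split_def)
  next
    fix p assume "p \<in> B"
    then obtain j b I where p: "p = (j, b, I)" and j: "j \<le> k div m"
      and b: "b \<in> weak_compositions n j" and I: "I \<subseteq> {1..n}" "card I = k - m * j"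
      by (auto simp: B_def)
    have join: "join p i = m * b i + of_bool (i \<in> I)" if "i \<in> {1..n}" for i
      using that by (simp add: join_def p)
    have div: "join p i div m = b i" and mod: "join p i mod m = of_bool (i \<in> I)"
      if "i \<in> {1..n}" for i
      \<comment> \<open>The indicator is less than \<open>m\<close>, so
        \<open>m * b i + of_bool (i \<in> I)\<close> already has the form of a division with
        remainder.\<close>
      using m that by (simp_all add: join)
    have sum_b: "(\<Sum>i=1..n. b i) = j"
      using b by (simp add: weak_compositions_def)
    have "(\<Sum>i=1..n. join p i) = (\<Sum>i=1..n. m * b i + of_bool (i \<in> I))"
      using join by (rule sum.cong[OF refl])
    also have "\<dots> = m * j + card I"
      by (simp only: sum.distrib sum_b sum_of_bool_mem_eq_card[OF I(1)] flip: sum_distrib_left)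
    also have "\<dots> = k"
      \<comment> \<open>The bound on \<open>j\<close> gives \<open>m * j \<le> k\<close>, so the
        natural-number subtraction in \<open>card I = k - m * j\<close> does not truncate.\<close>
      using j I(2) m by (simp add: less_eq_div_iff_mult_less_eq mult.commute)
    finally have "join p \<in> weak_compositions n k"
      by (simp add: weak_compositions_def join_def p)
    then show "join p \<in> A"
      using mod by (simp add: A_def)
    have "quot (join p) = b"
    proof
      fix i show "quot (join p) i = b i"
        using b div[of i] by (cases "i \<in> {1..n}")
          (auto simp: quot_def weak_compositions_def PiE_def extensional_def)
    qed
    moreover have "odds (join p) = I"
    proof -
      have "join p i mod m = 1 \<longleftrightarrow> i \<in> I" if "i \<in> {1..n}" for i
        using mod[OF that] by simp
      then show ?thesis
        using I(1) unfolding odds_def by blast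
    qed
    moreover have "(\<Sum>i=1..n. join p i div m) = j"
      using sum.cong[OF refl div] sum_b by (rule trans)
    ultimately show "split (join p) = p"
      by (simp add: split_def p)
  qed
  also have "\<dots> = (\<Sum>j=0..k div m. complete_hom n j (\<lambda>i. x i ^ m) * elem_sym n (k - m * j) x)"
    unfolding B_def complete_hom_def elem_sym_def sum_product sum.cartesian_product
    by (rule sum.Sigma[symmetric]) (auto simp: finite_weak_compositions)
  finally show ?thesis
    by (simp only: m_def)
qed

theorem theorem5p2:
  fixes k n s :: nat
  assumes "k > 0" and "n > 0" and "s > 0"
  shows "M_sym s n k (indet :: nat \<Rightarrow> 'a::comm_ring_1 mpoly) =
    (\<Sum>j=0..k div (s + 1).
       complete_hom n j (\<lambda>i. indet i ^ (s + 1)) * elem_sym n (k - (s + 1) * j) indet)"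
  using assms(3) by (rule M_sym_eq_sum_complete_hom_elem_sym)

end
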